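(* Let $A\in\mathbb{R}^{n\times d}$ have singular values $\sigma_1\ge\dots\ge\sigma_d>0$, let $1\le k<d$ and $\Delta>0$, and assume that $A$ is $(k,\Delta)$-separated, i.e. $\sigma_k^2-\sigma_{k+1}^2\ge\Delta\sigma_1^2$. Let $\mathrm{sr}(A)=\|A\|_F^2/\sigma_1^2$ and let $$0<\varepsilon\le\frac{\min(\Delta k^2,k)}{\mathrm{sr}(A)},\qquad \mu=\frac{\varepsilon^3\,\mathrm{sr}(A)^3}{125k^4}.$$ Let $\tilde A\in\mathbb{R}^{n\times\ell}$ satisfy $\|AA^T-\tilde A\tilde A^T\|\le\mu\sigma_1^2$. Then $$\sum_{i=1}^n|T^k(i)-\tilde T^k(i)|\le\frac{\varepsilon\|A\|_F^2}{\|A-A_k\|_F^2}\sum_{i=1}^nT^k(i).$$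
   Context: $\|\cdot\|$ is the operator norm and $\|\cdot\|_F$ the Frobenius norm; $a_{(i)}$ is the $i$-th row of $A$ (as a column vector) and $e_i$ the $i$-th standard basis vector of $\mathbb{R}^n$. Let $A=U\Sigma V^T$ and $\tilde A=\tilde U\tilde\Sigma\tilde V^T$ be SVDs with singular values in non-increasing order; $U_k,\tilde U_k\in\mathbb{R}^{n\times k}$ consist of the top $k$ left singular vectors, and $\Sigma_k,\tilde\Sigma_k$ are the $k\times k$ diagonal matrices of the top $k$ singular values of $A$ and $\tilde A$. $A_k=U_k\Sigma_kV_k^T$ is the rank-$k$ truncated SVD of $A$, where $V_k$ consists of the first $k$ columns of $V$. The rank-$k$ projection distance of row $i$ and its estimate are $$T^k(i)=\|a_{(i)}\|_2^2-\|e_i^TU_k\Sigma_k\|_2^2,\qquad \tilde T^k(i)=\|a_{(i)}\|_2^2-\|e_i^T\tilde U_k\tilde\Sigma_k\|_2^2.$$ *)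

theory Defs
  imports Complex_Main "Jordan_Normal_Form.Matrix"
begin

definition l2_norm :: "real vec \<Rightarrow> real" where
  "l2_norm v = sqrt (v \<bullet> v)"

definition op_norm :: "real mat \<Rightarrow> real" where
  "op_norm A = (SUP x \<in> {x \<in> carrier_vec (dim_col A). l2_norm x \<le> 1}. l2_norm (A *\<^sub>v x))"

definition frob_norm :: "real mat \<Rightarrow> real" where
  "frob_norm A = sqrt (\<Sum>i<dim_row A. \<Sum>j<dim_col A. (A $$ (i, j))\<^sup>2)"

text \<open>Full singular value decomposition: \<open>U\<close> and \<open>V\<close> are square orthogonal matrices and
  \<open>S\<close> is rectangular of the same shape as \<open>A\<close>. For a square matrix, one of the two orthogonality
  equations \<open>U\<^sup>T U = 1\<close>, \<open>U U\<^sup>T = 1\<close> implies the other.\<close>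

definition is_svd :: "real mat \<Rightarrow> real mat \<Rightarrow> real mat \<Rightarrow> real mat \<Rightarrow> bool" where
  "is_svd A U S V \<longleftrightarrow>
     U \<in> carrier_mat (dim_row A) (dim_row A) \<and> transpose_mat U * U = 1\<^sub>m (dim_row A) \<and>
     V \<in> carrier_mat (dim_col A) (dim_col A) \<and> transpose_mat V * V = 1\<^sub>m (dim_col A) \<and>
     S \<in> carrier_mat (dim_row A) (dim_col A) \<and> diagonal_mat S \<and>
     (\<forall>i < min (dim_row A) (dim_col A). S $$ (i, i) \<ge> 0) \<and>
     (\<forall>i j. i \<le> j \<longrightarrow> j < min (dim_row A) (dim_col A) \<longrightarrow> S $$ (j, j) \<le> S $$ (i, i)) \<and>
     A = U * S * transpose_mat V"

text \<open>Singular values are numbered from 1. An \<open>n \<times> d\<close> matrix has \<open>min n d\<close> of them; beyond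
  that the value is 0, so in particular positivity of the \<open>d\<close>-th one entails \<open>d \<le> n\<close>.\<close>

definition sing_val :: "real mat \<Rightarrow> nat \<Rightarrow> real" where
  "sing_val S i =
     (if 1 \<le> i \<and> i \<le> min (dim_row S) (dim_col S) then S $$ (i - 1, i - 1) else 0)"

text \<open>\<open>first_cols M k\<close> is meant for \<open>k \<le> dim_col M\<close> only.\<close>

definition first_cols :: "real mat \<Rightarrow> nat \<Rightarrow> real mat" where
  "first_cols M k = mat (dim_row M) k (\<lambda>(i, j). M $$ (i, j))"

definition top_sing :: "real mat \<Rightarrow> nat \<Rightarrow> real mat" where
  "top_sing S k = mat_diag k (\<lambda>i. sing_val S (i + 1))"

definition trunc_svd :: "real mat \<Rightarrow> real mat \<Rightarrow> real mat \<Rightarrow> nat \<Rightarrow> real mat" where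
  "trunc_svd U S V k = first_cols U k * top_sing S k * transpose_mat (first_cols V k)"

definition stable_rank :: "real mat \<Rightarrow> real mat \<Rightarrow> real" where
  "stable_rank A S = (frob_norm A)\<^sup>2 / (sing_val S 1)\<^sup>2"

text \<open>The row vector \<open>e\<^sub>i\<^sup>T U\<^sub>k \<Sigma>\<^sub>k\<close> is written as the column vector
  \<open>(U\<^sub>k \<Sigma>\<^sub>k)\<^sup>T e\<^sub>i\<close>. The rows always come from \<open>A\<close>, but \<open>U\<close>, \<open>S\<close> may belong to an SVD of
  another matrix with the same number of rows; this gives the estimated distance. Rows are numbered
  from 0.\<close>

definition proj_dist :: "real mat \<Rightarrow> real mat \<Rightarrow> real mat \<Rightarrow> nat \<Rightarrow> nat \<Rightarrow> real" where
  "proj_dist A U S k i =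
     (l2_norm (row A i))\<^sup>2 -
     (l2_norm (transpose_mat (first_cols U k * top_sing S k) *\<^sub>v unit_vec (dim_row A) i))\<^sup>2"

end

theory Submission
  imports Defs "Jordan_Normal_Form.Determinant" "HOL-Analysis.L2_Norm"
begin

text \<open>Since \<open>\<Sum>\<^sub>i T\<^sup>k(i) = \<parallel>A - A\<^sub>k\<parallel>\<^sub>F\<^sup>2 > 0\<close>, the claim is that the diagonals of the rank-\<open>k\<close> truncations of
  \<open>A A\<^sup>T\<close> and \<open>A' A'\<^sup>T\<close> differ by at most \<open>\<epsilon> \<parallel>A\<parallel>\<^sub>F\<^sup>2\<close> in \<open>\<ell>\<^sub>1\<close>. Instead of comparing singular subspaces,
  write the difference of the truncations in the mixed basis \<open>(u\<^sub>j, u'\<^sub>l)\<close> of left singular vectors of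
  \<open>A\<close> and \<open>A'\<close>. There each of its entries is a bounded multiple of the corresponding entry of
  \<open>A A\<^sup>T - A' A'\<^sup>T\<close>, the bound coming from the spectral gap and Weyl's inequality.\<close>

section \<open>Euclidean norm and Cauchy-Schwarz\<close>

text \<open>Makes the library facts on \<open>L2_set\<close>, such as Cauchy-Schwarz and
  monotonicity, available for \<open>l2_norm\<close>.\<close>

lemma l2_norm_eq_L2_set: "l2_norm v = L2_set (($) v) {..<dim_vec v}"
  by (simp add: l2_norm_def L2_set_def scalar_prod_def power2_eq_square lessThan_atLeast0)

lemma l2_norm_nonneg [simp]: "l2_norm v \<ge> 0"
  by (simp add: l2_norm_eq_L2_set)

lemma l2_norm_power2: "(l2_norm v)\<^sup>2 = (\<Sum>i<dim_vec v. (v $ i)\<^sup>2)"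
  by (simp add: l2_norm_eq_L2_set L2_set_def sum_nonneg)

text \<open>Cauchy-Schwarz with the absolute values inside the sum, the form in which errors of
  single rows can be added up.\<close>

lemma sum_abs_mult_le_l2_norm:
  assumes "v \<in> carrier_vec n" "w \<in> carrier_vec n"
  shows "(\<Sum>i<n. \<bar>v $ i * w $ i\<bar>) \<le> l2_norm v * l2_norm w"
  using L2_set_mult_ineq[of "($) v" "($) w" "{..<n}"] assms
  by (simp add: l2_norm_eq_L2_set abs_mult carrier_vecD)

lemma abs_scalar_prod_le_l2_norm:
  assumes "v \<in> carrier_vec n" "w \<in> carrier_vec n"
  shows "\<bar>v \<bullet> w\<bar> \<le> l2_norm v * l2_norm w"
proof -
  have "\<bar>v \<bullet> w\<bar> \<le> (\<Sum>i<n. \<bar>v $ i * w $ i\<bar>)"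
    using assms by (simp add: scalar_prod_def lessThan_atLeast0 carrier_vecD)
  then show ?thesis using sum_abs_mult_le_l2_norm[OF assms] by linarith
qed

lemma l2_norm_smult: "l2_norm (c \<cdot>\<^sub>v v) = \<bar>c\<bar> * l2_norm v"
proof -
  have "(c \<cdot>\<^sub>v v) \<bullet> (c \<cdot>\<^sub>v v) = c\<^sup>2 * (v \<bullet> v)"
    by (simp add: power2_eq_square)
  then show ?thesis by (simp add: l2_norm_def real_sqrt_mult)
qed

lemma l2_norm_eq_0_imp:
  assumes "l2_norm v = 0" "v \<in> carrier_vec n"
  shows "v = 0\<^sub>v n"
  using assms by (intro eq_vecI) (auto simp: l2_norm_eq_L2_set L2_set_eq_0_iff)

section \<open>Operator norm\<close>

text \<open>A real \<open>SUP\<close> is known to dominate its elements only if the set is bounded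
  above. The sum of the row norms is a crude but sufficient bound.\<close>

lemma bdd_above_op_norm:
  "bdd_above ((\<lambda>x. l2_norm (A *\<^sub>v x)) ` {x \<in> carrier_vec (dim_col A). l2_norm x \<le> 1})"
proof (rule bdd_aboveI2)
  fix x assume x: "x \<in> {x \<in> carrier_vec (dim_col A). l2_norm x \<le> 1}"
  have "l2_norm (A *\<^sub>v x) \<le> (\<Sum>i<dim_row A. \<bar>row A i \<bullet> x\<bar>)"
    using L2_set_le_sum_abs[of "($) (A *\<^sub>v x)" "{..<dim_row A}"]
    by (simp add: l2_norm_eq_L2_set)
  also have "\<dots> \<le> (\<Sum>i<dim_row A. l2_norm (row A i))"
  proof (rule sum_mono)
    fix i
    have "\<bar>row A i \<bullet> x\<bar> \<le> l2_norm (row A i) * l2_norm x"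
      using x by (intro abs_scalar_prod_le_l2_norm) auto
    also have "\<dots> \<le> l2_norm (row A i)"
      using x by (intro mult_left_le) auto
    finally show "\<bar>row A i \<bullet> x\<bar> \<le> l2_norm (row A i)" .
  qed
  finally show "l2_norm (A *\<^sub>v x) \<le> (\<Sum>i<dim_row A. l2_norm (row A i))" .
qed

text \<open>Scaling a vector of nonzero norm to norm 1 brings it into the unit ball over which
  \<open>op_norm\<close> takes its supremum.\<close>

lemma l2_norm_mult_mat_vec_le:
  assumes A: "A \<in> carrier_mat m n" and x: "x \<in> carrier_vec n"
  shows "l2_norm (A *\<^sub>v x) \<le> op_norm A * l2_norm x"
proof (cases "l2_norm x = 0")
  case True
  then have "x = 0\<^sub>v n" using x by (rule l2_norm_eq_0_imp)
  then have "A *\<^sub>v x = 0\<^sub>v m" using A by auto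
  then show ?thesis using True by (simp add: l2_norm_def)
next
  case False
  define y where "y = inverse (l2_norm x) \<cdot>\<^sub>v x"
  have y: "y \<in> carrier_vec n" "l2_norm y = 1"
    using x False by (auto simp: y_def l2_norm_smult)
  have "l2_norm (A *\<^sub>v y) \<le> op_norm A"
    unfolding op_norm_def using y A by (intro cSUP_upper bdd_above_op_norm) auto
  moreover have "l2_norm (A *\<^sub>v y) = inverse (l2_norm x) * l2_norm (A *\<^sub>v x)"
    using A x by (simp add: y_def mult_mat_vec l2_norm_smult)
  ultimately show ?thesis
    using False less_eq_real_def[of 0 "l2_norm x"] by (simp add: field_simps)
qed

section \<open>Orthogonal matrices and Frobenius norm\<close>

definition orthogonal_mat :: "nat \<Rightarrow> real mat \<Rightarrow> bool" where
  "orthogonal_mat n U \<longleftrightarrow> U \<in> carrier_mat n n \<and> transpose_mat U * U = 1\<^sub>m n"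

lemma orthogonal_matD:
  assumes "orthogonal_mat n U"
  shows "U \<in> carrier_mat n n" "transpose_mat U \<in> carrier_mat n n"
    "transpose_mat U * U = 1\<^sub>m n" "U * transpose_mat U = 1\<^sub>m n"
  using assms mat_mult_left_right_inverse[of "transpose_mat U" n U]
  by (auto simp: orthogonal_mat_def)

lemma orthogonal_mat_transpose:
  assumes "orthogonal_mat n U"
  shows "orthogonal_mat n (transpose_mat U)"
  using orthogonal_matD[OF assms] by (simp add: orthogonal_mat_def)

lemma l2_norm_orthogonal:
  assumes U: "orthogonal_mat n U" and x: "x \<in> carrier_vec n"
  shows "l2_norm (U *\<^sub>v x) = l2_norm x"
proof -
  note U = orthogonal_matD[OF U]
  have "(U *\<^sub>v x) \<bullet> (U *\<^sub>v x) = (transpose_mat U *\<^sub>v (U *\<^sub>v x)) \<bullet> x"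
    using transpose_vec_mult_scalar[OF U(1) x] U x by (simp add: comm_scalar_prod[of _ n])
  also have "transpose_mat U *\<^sub>v (U *\<^sub>v x) = x"
    using U x by (simp flip: assoc_mult_mat_vec)
  finally show ?thesis by (simp add: l2_norm_def)
qed

text \<open>Diagonal entry \<open>j\<close> of \<open>transpose_mat U * U\<close> is the squared
  norm of column \<open>j\<close>.\<close>

lemma l2_norm_col_orthogonal:
  assumes U: "orthogonal_mat n U" and j: "j < n"
  shows "l2_norm (col U j) = 1"
  using index_mult_mat(1)[of j "transpose_mat U" j U] orthogonal_matD[OF U] j
  by (simp add: l2_norm_def)

lemma frob_norm_power2: "(frob_norm A)\<^sup>2 = (\<Sum>i<dim_row A. \<Sum>j<dim_col A. (A $$ (i, j))\<^sup>2)"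
  by (simp add: frob_norm_def sum_nonneg)

lemma frob_norm_power2_rows: "(frob_norm A)\<^sup>2 = (\<Sum>i<dim_row A. (l2_norm (row A i))\<^sup>2)"
  by (simp add: frob_norm_power2 l2_norm_power2)

lemma frob_norm_transpose: "frob_norm (transpose_mat A) = frob_norm A"
  unfolding frob_norm_def by (subst sum.swap) simp

text \<open>The squared Frobenius norm is the sum of the squared column norms, and every column of
  \<open>U * R\<close> is \<open>U\<close> applied to a column of \<open>R\<close>.\<close>

lemma frob_norm_orthogonal_left:
  assumes U: "orthogonal_mat m U" and R: "R \<in> carrier_mat m n"
  shows "frob_norm (U * R) = frob_norm R"
proof -
  have *: "(frob_norm A)\<^sup>2 = (\<Sum>j<dim_col A. (l2_norm (col A j))\<^sup>2)" for A
    using frob_norm_power2_rows[of "transpose_mat A"] by (simp add: frob_norm_transpose)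
  have "(frob_norm (U * R))\<^sup>2 = (frob_norm R)\<^sup>2"
    unfolding * using R orthogonal_matD(1)[OF U]
    by (auto intro!: sum.cong simp: l2_norm_orthogonal[OF U] col_mult2[of _ m m _ n] simp del: col_mult)
  moreover have "frob_norm A \<ge> 0" for A
    by (simp add: frob_norm_def sum_nonneg)
  ultimately show ?thesis by (simp add: power2_eq_iff_nonneg)
qed

text \<open>Transposition turns the right factor into a left one.\<close>

lemma frob_norm_orthogonal:
  assumes U: "orthogonal_mat m U" and V: "orthogonal_mat n V" and R: "R \<in> carrier_mat m n"
  shows "frob_norm (U * R * transpose_mat V) = frob_norm R"
proof -
  note c = orthogonal_matD[OF U] orthogonal_matD[OF V] R
  have "frob_norm (U * R * transpose_mat V) = frob_norm (V * transpose_mat (U * R))"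
    by (subst frob_norm_transpose[symmetric])
       (subst transpose_mult[of _ m n _ n], use c in auto)
  also have "\<dots> = frob_norm (U * R)"
    using c by (subst frob_norm_orthogonal_left[OF V, of _ m]) (auto simp: frob_norm_transpose)
  also have "\<dots> = frob_norm R"
    by (rule frob_norm_orthogonal_left[OF U R])
  finally show ?thesis .
qed

section \<open>Conjugated diagonal matrices and Weyl's inequality\<close>

lemma mat_diag_mult_vec:
  fixes a :: "nat \<Rightarrow> real"
  assumes v: "v \<in> carrier_vec n"
  shows "mat_diag n a *\<^sub>v v = vec n (\<lambda>j. a j * v $ j)"
proof (rule eq_vecI)
  fix j assume "j < dim_vec (vec n (\<lambda>j. a j * v $ j))"
  then have j: "j < n" by simp
  have "(mat_diag n a *\<^sub>v v) $ j = (\<Sum>i<n. (if j = i then a i else 0) * v $ i)"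
    using v j by (simp add: mat_diag_def scalar_prod_def lessThan_atLeast0)
  also have "\<dots> = (\<Sum>i<n. if j = i then a i * v $ i else 0)"
    by (intro sum.cong) auto
  finally show "(mat_diag n a *\<^sub>v v) $ j = vec n (\<lambda>j. a j * v $ j) $ j"
    using j by (simp add: sum.delta)
qed (simp add: mat_diag_def)

lemma mult_mat_diag_conjugate:
  assumes U: "orthogonal_mat n U" and x: "x \<in> carrier_vec n"
  shows "(U * mat_diag n a * transpose_mat U) *\<^sub>v x = U *\<^sub>v (mat_diag n a *\<^sub>v (transpose_mat U *\<^sub>v x))"
proof -
  note c = orthogonal_matD[OF U]
  have "(U * mat_diag n a * transpose_mat U) *\<^sub>v x = (U * mat_diag n a) *\<^sub>v (transpose_mat U *\<^sub>v x)"
    by (rule assoc_mult_mat_vec[OF mult_carrier_mat[OF c(1) mat_diag_dim] c(2) x])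
  also have "\<dots> = U *\<^sub>v (mat_diag n a *\<^sub>v (transpose_mat U *\<^sub>v x))"
    by (rule assoc_mult_mat_vec[OF c(1) mat_diag_dim mult_mat_vec_carrier[OF c(2) x]])
  finally show ?thesis .
qed

lemma scalar_prod_mat_diag_conjugate:
  assumes U: "orthogonal_mat n U" and x: "x \<in> carrier_vec n"
  shows "x \<bullet> ((U * mat_diag n a * transpose_mat U) *\<^sub>v x)
    = (\<Sum>j<n. a j * ((transpose_mat U *\<^sub>v x) $ j)\<^sup>2)"
proof -
  note c = orthogonal_matD[OF U]
  define y where "y = transpose_mat U *\<^sub>v x"
  have y: "y \<in> carrier_vec n" using c x by (simp add: y_def)
  have "x \<bullet> ((U * mat_diag n a * transpose_mat U) *\<^sub>v x) = y \<bullet> (mat_diag n a *\<^sub>v y)"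
    unfolding mult_mat_diag_conjugate[OF U x] y_def
    by (rule transpose_vec_mult_scalar[OF c(1) _ x, symmetric])
       (rule mult_mat_vec_carrier[OF mat_diag_dim mult_mat_vec_carrier[OF c(2) x]])
  also have "\<dots> = (\<Sum>j<n. a j * (y $ j)\<^sup>2)"
    by (simp add: mat_diag_mult_vec[OF y] scalar_prod_def lessThan_atLeast0 power2_eq_square
        mult.left_commute)
  finally show ?thesis by (simp add: y_def)
qed

text \<open>By a dimension count, the span of the first \<open>k + 1\<close> columns of \<open>U'\<close> meets the span of the
  columns of \<open>U\<close> from the \<open>k\<close>-th on; this is the vector \<open>v\<close> (in the basis \<open>U'\<close>). The square
  matrix \<open>Q\<close> encodes both conditions, with a zero row to spare.\<close>

lemma weyl_inequality:
  assumes U: "orthogonal_mat n U" and U': "orthogonal_mat n U'"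
    and a: "\<And>i j. i \<le> j \<Longrightarrow> j < n \<Longrightarrow> a j \<le> a i"
    and b: "\<And>i j. i \<le> j \<Longrightarrow> j < n \<Longrightarrow> b j \<le> b i"
    and k: "k < n"
    and le: "\<And>x. x \<in> carrier_vec n \<Longrightarrow>
      x \<bullet> ((U' * mat_diag n b * transpose_mat U') *\<^sub>v x)
      \<le> x \<bullet> ((U * mat_diag n a * transpose_mat U) *\<^sub>v x) + e * (l2_norm x)\<^sup>2"
  shows "b k \<le> a k + e"
proof -
  note c = orthogonal_matD[OF U] orthogonal_matD[OF U']
  \<comment> \<open>\<open>W\<close> turns coordinates with respect to the columns of
    \<open>U'\<close> into coordinates with respect to the columns of \<open>U\<close>.\<close>
  define W where "W = transpose_mat U * U'"
  have W: "W \<in> carrier_mat n n" using c by (simp add: W_def)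
  define Q where "Q = mat\<^sub>r n n
    (\<lambda>j. if j = k then 0\<^sub>v n else if j < k then row W j else unit_vec n j)"
  have "det Q = 0"
    unfolding Q_def by (rule det_row_0[OF k]) (use W in auto)
  moreover have Q: "Q \<in> carrier_mat n n" by (simp add: Q_def)
  ultimately obtain v where v: "v \<in> carrier_vec n" "v \<noteq> 0\<^sub>v n" "Q *\<^sub>v v = 0\<^sub>v n"
    using det_0_iff_vec_prod_zero_field[OF Q] by blast
  have Qv: "row Q j \<bullet> v = 0" if "j < n" for j
    using arg_cong[OF v(3), of "\<lambda>w. w $ j"] that Q by simp
  have v_high: "v $ j = 0" if "k < j" "j < n" for j
    using Qv[OF that(2)] that v(1) by (simp add: Q_def)
  have Wv_low: "(W *\<^sub>v v) $ j = 0" if "j < k" for j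
    using Qv[of j] that k W by (simp add: Q_def)
  define x where "x = U' *\<^sub>v v"
  have x: "x \<in> carrier_vec n" using c v by (simp add: x_def)
  have U'x: "transpose_mat U' *\<^sub>v x = v"
    using c v(1) by (simp add: x_def flip: assoc_mult_mat_vec)
  have Ux: "transpose_mat U *\<^sub>v x = W *\<^sub>v v"
    using c v(1) by (simp add: x_def W_def)
  have norm_v: "l2_norm v = l2_norm x"
    using l2_norm_orthogonal[OF U' v(1)] by (simp add: x_def)
  have norm_Wv: "l2_norm (W *\<^sub>v v) = l2_norm x"
    using l2_norm_orthogonal[OF orthogonal_mat_transpose[OF U] x] by (simp add: Ux)
  \<comment> \<open>In the basis \<open>U'\<close> the vector \<open>x\<close> has only coordinates
    \<open>j \<le> k\<close>, where \<open>b j \<ge> b k\<close>; in the basis \<open>U\<close> only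
    coordinates \<open>j \<ge> k\<close>, where \<open>a j \<le> a k\<close>. Evaluating both forms
    at \<open>x\<close> thus compares \<open>b k\<close> with \<open>a k\<close>.\<close>
  have "b k * (l2_norm x)\<^sup>2 = (\<Sum>j<n. b k * (v $ j)\<^sup>2)"
    using v by (simp add: sum_distrib_left l2_norm_power2 flip: norm_v)
  also have "\<dots> \<le> (\<Sum>j<n. b j * (v $ j)\<^sup>2)"
  proof (rule sum_mono)
    fix j assume "j \<in> {..<n}"
    then show "b k * (v $ j)\<^sup>2 \<le> b j * (v $ j)\<^sup>2"
      using v_high[of j] b[of j k] k by (cases "k < j") (auto intro: mult_right_mono)
  qed
  also have "\<dots> \<le> (\<Sum>j<n. a j * ((W *\<^sub>v v) $ j)\<^sup>2) + e * (l2_norm x)\<^sup>2"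
    using le[OF x] by (simp only: scalar_prod_mat_diag_conjugate[OF U x]
        scalar_prod_mat_diag_conjugate[OF U' x] Ux U'x)
  also have "(\<Sum>j<n. a j * ((W *\<^sub>v v) $ j)\<^sup>2) \<le> (\<Sum>j<n. a k * ((W *\<^sub>v v) $ j)\<^sup>2)"
  proof (rule sum_mono)
    fix j assume "j \<in> {..<n}"
    then show "a j * ((W *\<^sub>v v) $ j)\<^sup>2 \<le> a k * ((W *\<^sub>v v) $ j)\<^sup>2"
      using Wv_low[of j] a[of k j] by (cases "j < k") (auto intro: mult_right_mono)
  qed
  also have "\<dots> = a k * (l2_norm x)\<^sup>2"
    using W by (simp add: sum_distrib_left l2_norm_power2 flip: norm_Wv)
  finally have "b k * (l2_norm x)\<^sup>2 \<le> (a k + e) * (l2_norm x)\<^sup>2"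
    by (simp add: algebra_simps)
  moreover have "(l2_norm x)\<^sup>2 > 0"
    using l2_norm_eq_0_imp[OF _ v(1)] v(2) by (auto simp flip: norm_v)
  ultimately show ?thesis by simp
qed

section \<open>Perturbation and truncation in the mixed basis\<close>

lemma l2_norm_minus_commute:
  assumes "v \<in> carrier_vec n" "w \<in> carrier_vec n"
  shows "l2_norm (v - w) = l2_norm (w - v)"
  using assms by (simp add: l2_norm_eq_L2_set L2_set_def power2_commute cong: sum.cong_simp)

lemma l2_norm_vec_le_mult:
  assumes "C \<ge> 0" and "\<And>l. l < n \<Longrightarrow> \<bar>f l\<bar> \<le> C * \<bar>g l\<bar>"
  shows "l2_norm (vec n f) \<le> C * l2_norm (vec n g)"
proof -
  have "l2_norm (vec n f) = L2_set (\<lambda>l. \<bar>f l\<bar>) {..<n}"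
    by (simp add: l2_norm_eq_L2_set L2_set_def)
  also have "\<dots> \<le> L2_set (\<lambda>l. C * \<bar>g l\<bar>) {..<n}"
    using assms by (intro L2_set_mono) auto
  also have "\<dots> = C * L2_set (\<lambda>l. \<bar>g l\<bar>) {..<n}"
    by (rule L2_set_right_distrib[OF assms(1), symmetric])
  also have "\<dots> = C * l2_norm (vec n g)"
    by (simp add: l2_norm_eq_L2_set L2_set_def)
  finally show ?thesis .
qed

text \<open>Column \<open>j\<close> of \<open>U\<close> has the coordinates
  \<open>unit_vec n j\<close>, which the diagonal matrix only scales.\<close>

lemma mat_diag_conjugate_mult_col:
  assumes U: "orthogonal_mat n U" and j: "j < n"
  shows "(U * mat_diag n a * transpose_mat U) *\<^sub>v col U j = a j \<cdot>\<^sub>v col U j"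
proof -
  note c = orthogonal_matD[OF U]
  have "transpose_mat U *\<^sub>v col U j = unit_vec n j"
    using col_mult2[OF c(2,1) j] c(3) j by simp
  moreover have "mat_diag n a *\<^sub>v unit_vec n j = a j \<cdot>\<^sub>v unit_vec n j"
    by (simp add: mat_diag_mult_vec) (auto intro!: eq_vecI simp: unit_vec_def)
  moreover have "U *\<^sub>v unit_vec n j = col U j"
    using c(1) j by (intro eq_vecI) auto
  ultimately show ?thesis
    using c(1) j mult_mat_diag_conjugate[OF U, of "col U j" a] by (simp add: mult_mat_vec[OF c(1)])
qed

text \<open>In the mixed basis the perturbation has the entries \<open>(a\<^sub>j - b\<^sub>l) \<langle>u\<^sub>j, u'\<^sub>l\<rangle>\<close>.\<close>

lemma l2_norm_mixed_basis_row_le: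
  assumes U: "orthogonal_mat n U" and U': "orthogonal_mat n U'" and j: "j < n"
    and le: "\<And>x. x \<in> carrier_vec n \<Longrightarrow>
      l2_norm ((U * mat_diag n a * transpose_mat U) *\<^sub>v x
        - (U' * mat_diag n b * transpose_mat U') *\<^sub>v x) \<le> e * l2_norm x"
  shows "l2_norm (vec n (\<lambda>l. (a j - b l) * (col U j \<bullet> col U' l))) \<le> e"
proof -
  note c = orthogonal_matD[OF U] and c' = orthogonal_matD[OF U']
  let ?x = "col U j"
  let ?B = "U * mat_diag n a * transpose_mat U" and ?B' = "U' * mat_diag n b * transpose_mat U'"
  define y where "y = transpose_mat U' *\<^sub>v ?x"
  have x: "?x \<in> carrier_vec n" using c by (simp add: carrier_vecI)
  have y: "y \<in> carrier_vec n" using c' x by (simp add: y_def)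
  have y_nth: "y $ l = ?x \<bullet> col U' l" if "l < n" for l
    using that c' x by (simp add: y_def comm_scalar_prod[of _ n])
  have z: "mat_diag n b *\<^sub>v y \<in> carrier_vec n" by (rule mult_mat_vec_carrier[OF mat_diag_dim y])
  have B'x: "?B' *\<^sub>v ?x = U' *\<^sub>v (mat_diag n b *\<^sub>v y)"
    unfolding y_def by (rule mult_mat_diag_conjugate[OF U' x])
  have "?B' *\<^sub>v ?x \<in> carrier_vec n"
    unfolding B'x by (rule mult_mat_vec_carrier[OF c'(1) z])
  \<comment> \<open>The perturbation maps \<open>?x\<close> to
    \<open>a j \<cdot>\<^sub>v ?x - ?B' *\<^sub>v ?x\<close>. The vector of the claim consists of
    the coordinates of this image in the basis \<open>U'\<close>, and passing to coordinates
    preserves the norm.\<close>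
  then have "transpose_mat U' *\<^sub>v (a j \<cdot>\<^sub>v ?x - ?B' *\<^sub>v ?x)
      = transpose_mat U' *\<^sub>v (a j \<cdot>\<^sub>v ?x) - transpose_mat U' *\<^sub>v (?B' *\<^sub>v ?x)"
    using x by (intro mult_minus_distrib_mat_vec[OF c'(2)]) auto
  also have "transpose_mat U' *\<^sub>v (a j \<cdot>\<^sub>v ?x) = a j \<cdot>\<^sub>v y"
    unfolding y_def by (rule mult_mat_vec[OF c'(2) x])
  also have "transpose_mat U' *\<^sub>v (?B' *\<^sub>v ?x) = mat_diag n b *\<^sub>v y"
    unfolding B'x using c' z by (simp flip: assoc_mult_mat_vec)
  also have "a j \<cdot>\<^sub>v y - mat_diag n b *\<^sub>v y = vec n (\<lambda>l. (a j - b l) * (?x \<bullet> col U' l))"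
    unfolding mat_diag_mult_vec[OF y] using y
    by (intro eq_vecI) (auto simp: algebra_simps y_nth)
  finally have "l2_norm (vec n (\<lambda>l. (a j - b l) * (?x \<bullet> col U' l)))
      = l2_norm (a j \<cdot>\<^sub>v ?x - ?B' *\<^sub>v ?x)"
    using \<open>?B' *\<^sub>v ?x \<in> carrier_vec n\<close> x
      l2_norm_orthogonal[OF orthogonal_mat_transpose[OF U'], of "a j \<cdot>\<^sub>v ?x - ?B' *\<^sub>v ?x"]
    by simp
  also have "\<dots> \<le> e"
    using le[OF x] by (simp add: mat_diag_conjugate_mult_col[OF U j] l2_norm_col_orthogonal[OF U j])
  finally show ?thesis .
qed

text \<open>The difference of the two truncations has the entries \<open>(\<alpha>\<^sub>j - \<beta>\<^sub>l) \<langle>u\<^sub>j, u'\<^sub>l\<rangle>\<close> in the mixed basis,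
  where \<open>\<alpha>\<close> and \<open>\<beta>\<close> are \<open>a\<close> and \<open>b\<close> cut off at \<open>k\<close>. These vanish unless \<open>j < k\<close> or \<open>l < k\<close>,
  and are at most \<open>C\<close> times those of the perturbation. The \<open>k\<close> rows and the \<open>k\<close> remaining parts
  of columns contribute \<open>C e\<close> each, by Cauchy--Schwarz.\<close>

lemma sum_abs_diag_truncation_diff_le:
  assumes U: "orthogonal_mat n U" and U': "orthogonal_mat n U'" and kn: "k \<le> n"
    and C: "C \<ge> 1"
    and aC: "\<And>j l. j < k \<Longrightarrow> k \<le> l \<Longrightarrow> l < n \<Longrightarrow> \<bar>a j\<bar> \<le> C * \<bar>a j - b l\<bar>"
    and bC: "\<And>j l. l < k \<Longrightarrow> k \<le> j \<Longrightarrow> j < n \<Longrightarrow> \<bar>b l\<bar> \<le> C * \<bar>a j - b l\<bar>"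
    and le: "\<And>x. x \<in> carrier_vec n \<Longrightarrow>
      l2_norm ((U * mat_diag n a * transpose_mat U) *\<^sub>v x
        - (U' * mat_diag n b * transpose_mat U') *\<^sub>v x) \<le> e * l2_norm x"
  shows "(\<Sum>i<n. \<bar>(\<Sum>j<k. a j * (U $$ (i, j))\<^sup>2) - (\<Sum>l<k. b l * (U' $$ (i, l))\<^sup>2)\<bar>) \<le> 2 * real k * C * e"
proof -
  note c = orthogonal_matD[OF U] and c' = orthogonal_matD[OF U']
  define w where "w j l = col U j \<bullet> col U' l" for j l
  define \<alpha> where "\<alpha> j = (if j < k then a j else 0)" for j
  define \<beta> where "\<beta> l = (if l < k then b l else 0)" for l
  define M where "M j l = (\<alpha> j - \<beta> l) * w j l" for j l
  \<comment> \<open>\<open>r j\<close> is row \<open>j\<close> of \<open>M\<close>;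
    \<open>s l\<close> is column \<open>l\<close> with the entries that already belong to the first
    \<open>k\<close> rows set to 0.\<close>
  define r where "r j = vec n (\<lambda>l. M j l)" for j
  define s where "s l = vec n (\<lambda>j. if j < k then 0 else M j l)" for l
  have w1: "(\<Sum>l<n. w j l * U' $$ (i, l)) = U $$ (i, j)" if "i < n" "j < n" for i j
  proof -
    have "U $$ (i, j) = (U' *\<^sub>v (transpose_mat U' *\<^sub>v col U j)) $ i"
      using that c c' by (simp flip: assoc_mult_mat_vec[of _ n n _ n])
    also have "\<dots> = (\<Sum>l<n. w j l * U' $$ (i, l))"
      using that c c' by (simp add: scalar_prod_def[of "row U' i"] lessThan_atLeast0 w_def
          comm_scalar_prod[of "col U' _" n] mult.commute)
    finally show ?thesis ..
  qed
  have w2: "(\<Sum>j<n. U $$ (i, j) * w j l) = U' $$ (i, l)" if "i < n" "l < n" for i l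
  proof -
    have "U' $$ (i, l) = (U *\<^sub>v (transpose_mat U *\<^sub>v col U' l)) $ i"
      using that c c' by (simp flip: assoc_mult_mat_vec[of _ n n _ n])
    also have "\<dots> = (\<Sum>j<n. U $$ (i, j) * w j l)"
      using that c c' by (simp add: scalar_prod_def[of "row U i"] lessThan_atLeast0 w_def)
    finally show ?thesis ..
  qed
  have cut: "(\<Sum>j<n. (if j < k then f j else 0)) = (\<Sum>j<k. f j)" for f :: "nat \<Rightarrow> real"
    by (rule sum.mono_neutral_cong_right) (use kn in auto)
  have cut': "(\<Sum>j<n. (if j < k then 0 else f j)) = (\<Sum>j\<in>{k..<n}. f j)" for f :: "nat \<Rightarrow> real"
    by (rule sum.mono_neutral_cong_right) auto
  have split: "(\<Sum>j<k. a j * (U $$ (i, j))\<^sup>2) - (\<Sum>l<k. b l * (U' $$ (i, l))\<^sup>2)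
      = (\<Sum>j<k. col U j $ i * (U' *\<^sub>v r j) $ i) + (\<Sum>l<k. (U *\<^sub>v s l) $ i * col U' l $ i)"
    if i: "i < n" for i
  proof -
    \<comment> \<open>One of the two factors in each square is expanded in the other basis, so that
      both sums become double sums over the same products.\<close>
    have "(\<Sum>j<k. a j * (U $$ (i, j))\<^sup>2) = (\<Sum>j<n. \<alpha> j * U $$ (i, j) * (\<Sum>l<n. w j l * U' $$ (i, l)))"
      unfolding cut[symmetric] using i
      by (intro sum.cong) (auto simp: \<alpha>_def w1 power2_eq_square)
    moreover have "(\<Sum>l<k. b l * (U' $$ (i, l))\<^sup>2) = (\<Sum>l<n. \<beta> l * U' $$ (i, l) * (\<Sum>j<n. U $$ (i, j) * w j l))"
      unfolding cut[symmetric] using i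
      by (intro sum.cong) (auto simp: \<beta>_def w2 power2_eq_square)
    ultimately have "(\<Sum>j<k. a j * (U $$ (i, j))\<^sup>2) - (\<Sum>l<k. b l * (U' $$ (i, l))\<^sup>2)
      = (\<Sum>j<n. \<Sum>l<n. \<alpha> j * U $$ (i, j) * (w j l * U' $$ (i, l)))
        - (\<Sum>l<n. \<Sum>j<n. \<beta> l * U' $$ (i, l) * (U $$ (i, j) * w j l))"
      by (simp only: sum_distrib_left)
    also have "(\<Sum>l<n. \<Sum>j<n. \<beta> l * U' $$ (i, l) * (U $$ (i, j) * w j l))
        = (\<Sum>j<n. \<Sum>l<n. \<beta> l * U' $$ (i, l) * (U $$ (i, j) * w j l))"
      by (rule sum.swap)
    also have "(\<Sum>j<n. \<Sum>l<n. \<alpha> j * U $$ (i, j) * (w j l * U' $$ (i, l))) - \<dots>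
        = (\<Sum>j<n. \<Sum>l<n. U $$ (i, j) * M j l * U' $$ (i, l))"
      unfolding sum_subtractf[symmetric]
      by (intro sum.cong refl) (simp add: M_def algebra_simps)
    also have "\<dots> = (\<Sum>j<k. \<Sum>l<n. U $$ (i, j) * M j l * U' $$ (i, l))
        + (\<Sum>j\<in>{k..<n}. \<Sum>l<n. U $$ (i, j) * M j l * U' $$ (i, l))"
      using kn by (simp add: lessThan_atLeast0 sum.atLeastLessThan_concat)
    \<comment> \<open>If \<open>j\<close> and \<open>l\<close> are both at least \<open>k\<close>,
      then \<alpha> and \<beta> are both 0, so the rows from \<open>k\<close> on contribute only
      their first \<open>k\<close> columns.\<close>
    also have "(\<Sum>j\<in>{k..<n}. \<Sum>l<n. U $$ (i, j) * M j l * U' $$ (i, l))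
        = (\<Sum>j\<in>{k..<n}. \<Sum>l<k. U $$ (i, j) * M j l * U' $$ (i, l))"
      by (intro sum.cong refl sum.mono_neutral_right)
         (use kn in \<open>auto simp: M_def \<alpha>_def \<beta>_def\<close>)
    also have "\<dots> = (\<Sum>l<k. \<Sum>j\<in>{k..<n}. U $$ (i, j) * M j l * U' $$ (i, l))"
      by (rule sum.swap)
    also have "(\<Sum>j<k. \<Sum>l<n. U $$ (i, j) * M j l * U' $$ (i, l)) = (\<Sum>j<k. col U j $ i * (U' *\<^sub>v r j) $ i)"
      using i kn c c' by (intro sum.cong refl)
        (simp add: r_def scalar_prod_def lessThan_atLeast0 sum_distrib_left mult_ac)
    also have "(\<Sum>l<k. \<Sum>j\<in>{k..<n}. U $$ (i, j) * M j l * U' $$ (i, l)) = (\<Sum>l<k. (U *\<^sub>v s l) $ i * col U' l $ i)"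
    proof (rule sum.cong[OF refl])
      fix l assume l: "l \<in> {..<k}"
      have "(U *\<^sub>v s l) $ i = (\<Sum>j<n. U $$ (i, j) * (if j < k then 0 else M j l))"
        using i c by (simp add: s_def scalar_prod_def lessThan_atLeast0)
      also have "\<dots> = (\<Sum>j<n. if j < k then 0 else U $$ (i, j) * M j l)"
        by (intro sum.cong) auto
      finally have "(U *\<^sub>v s l) $ i = (\<Sum>j\<in>{k..<n}. U $$ (i, j) * M j l)"
        by (simp add: cut')
      then show "(\<Sum>j\<in>{k..<n}. U $$ (i, j) * M j l * U' $$ (i, l)) = (U *\<^sub>v s l) $ i * col U' l $ i"
        using i l kn c' by (simp add: sum_distrib_right)
    qed
    finally show ?thesis .
  qed
  have r: "l2_norm (r j) \<le> C * e" if j: "j < k" for j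
  proof -
    have "\<bar>M j l\<bar> \<le> C * \<bar>(a j - b l) * w j l\<bar>" if "l < n" for l
    proof -
      \<comment> \<open>For \<open>l < k\<close> nothing is cut off and \<open>C \<ge> 1\<close>
        suffices; otherwise the left-hand side is \<open>\<bar>a j\<bar>\<close>, which
        \<open>aC\<close> bounds.\<close>
      have "\<bar>\<alpha> j - \<beta> l\<bar> \<le> C * \<bar>a j - b l\<bar>"
        using aC[OF j _ that] j mult_right_mono[OF C, of "\<bar>a j - b l\<bar>"] by (auto simp: \<alpha>_def \<beta>_def)
      then show ?thesis
        using mult_right_mono[of _ _ "\<bar>w j l\<bar>"] by (fastforce simp: M_def abs_mult)
    qed
    then have "l2_norm (r j) \<le> C * l2_norm (vec n (\<lambda>l. (a j - b l) * w j l))"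
      unfolding r_def using C by (intro l2_norm_vec_le_mult) auto
    also have "\<dots> \<le> C * e"
      unfolding w_def using C j kn
      by (intro mult_left_mono l2_norm_mixed_basis_row_le[OF U U' _ le]) auto
    finally show ?thesis .
  qed
  \<comment> \<open>Columns of \<open>M\<close> are treated as rows, with the two bases
    exchanged.\<close>
  have le': "l2_norm ((U' * mat_diag n b * transpose_mat U') *\<^sub>v x
        - (U * mat_diag n a * transpose_mat U) *\<^sub>v x) \<le> e * l2_norm x" if "x \<in> carrier_vec n" for x
    using le[OF that]
    by (subst l2_norm_minus_commute[of _ n])
       (auto intro!: mult_mat_vec_carrier[OF mult_carrier_mat[OF mult_carrier_mat]] that c c' mat_diag_dim)
  have s: "l2_norm (s l) \<le> C * e" if l: "l < k" for l
  proof -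
    have "\<bar>if j < k then 0 else M j l\<bar> \<le> C * \<bar>(b l - a j) * (col U' l \<bullet> col U j)\<bar>" if "j < n" for j
    proof (cases "j < k")
      case True
      then show ?thesis using C by simp
    next
      case False
      then have "\<bar>\<alpha> j - \<beta> l\<bar> \<le> C * \<bar>b l - a j\<bar>"
        using bC[OF l _ that] l by (simp add: \<alpha>_def \<beta>_def abs_minus_commute)
      moreover have "col U' l \<bullet> col U j = w j l"
        unfolding w_def using c c' by (intro comm_scalar_prod[of _ n]) (auto simp: carrier_vecI)
      ultimately show ?thesis
        using False mult_right_mono[of _ _ "\<bar>w j l\<bar>"] by (fastforce simp: M_def abs_mult)
    qed
    then have "l2_norm (s l) \<le> C * l2_norm (vec n (\<lambda>j. (b l - a j) * (col U' l \<bullet> col U j)))"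
      unfolding s_def using C by (intro l2_norm_vec_le_mult) auto
    also have "\<dots> \<le> C * e"
      using C l kn by (intro mult_left_mono l2_norm_mixed_basis_row_le[OF U' U _ le']) auto
    finally show ?thesis .
  qed
  have rterm: "(\<Sum>i<n. \<bar>col U j $ i * (U' *\<^sub>v r j) $ i\<bar>) \<le> C * e" if j: "j < k" for j
  proof -
    have "(\<Sum>i<n. \<bar>col U j $ i * (U' *\<^sub>v r j) $ i\<bar>) \<le> l2_norm (col U j) * l2_norm (U' *\<^sub>v r j)"
      using c c' by (intro sum_abs_mult_le_l2_norm) (auto simp: r_def carrier_vecI)
    also have "\<dots> = l2_norm (r j)"
      using j kn l2_norm_col_orthogonal[OF U] l2_norm_orthogonal[OF U'] by (simp add: r_def)
    finally show ?thesis using r[OF j] by linarith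
  qed
  have sterm: "(\<Sum>i<n. \<bar>(U *\<^sub>v s l) $ i * col U' l $ i\<bar>) \<le> C * e" if l: "l < k" for l
  proof -
    have "(\<Sum>i<n. \<bar>(U *\<^sub>v s l) $ i * col U' l $ i\<bar>) \<le> l2_norm (U *\<^sub>v s l) * l2_norm (col U' l)"
      using c c' by (intro sum_abs_mult_le_l2_norm) (auto simp: s_def carrier_vecI)
    also have "\<dots> = l2_norm (s l)"
      using l kn l2_norm_col_orthogonal[OF U'] l2_norm_orthogonal[OF U] by (simp add: s_def)
    finally show ?thesis using s[OF l] by linarith
  qed
  have "(\<Sum>i<n. \<bar>(\<Sum>j<k. a j * (U $$ (i, j))\<^sup>2) - (\<Sum>l<k. b l * (U' $$ (i, l))\<^sup>2)\<bar>)
    \<le> (\<Sum>i<n. (\<Sum>j<k. \<bar>col U j $ i * (U' *\<^sub>v r j) $ i\<bar>) + (\<Sum>l<k. \<bar>(U *\<^sub>v s l) $ i * col U' l $ i\<bar>))"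
  proof (rule sum_mono)
    fix i assume "i \<in> {..<n}"
    then have i: "i < n" by simp
    show "\<bar>(\<Sum>j<k. a j * (U $$ (i, j))\<^sup>2) - (\<Sum>l<k. b l * (U' $$ (i, l))\<^sup>2)\<bar>
      \<le> (\<Sum>j<k. \<bar>col U j $ i * (U' *\<^sub>v r j) $ i\<bar>) + (\<Sum>l<k. \<bar>(U *\<^sub>v s l) $ i * col U' l $ i\<bar>)"
      unfolding split[OF i] by (intro order_trans[OF abs_triangle_ineq] add_mono sum_abs)
  qed
  also have "\<dots> = (\<Sum>j<k. \<Sum>i<n. \<bar>col U j $ i * (U' *\<^sub>v r j) $ i\<bar>)
      + (\<Sum>l<k. \<Sum>i<n. \<bar>(U *\<^sub>v s l) $ i * col U' l $ i\<bar>)"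
    unfolding sum.distrib by (intro arg_cong2[of _ _ _ _ "(+)"] sum.swap)
  also have "\<dots> \<le> (\<Sum>j<k. C * e) + (\<Sum>l<k. C * e)"
    using rterm sterm by (intro add_mono sum_mono) auto
  finally show ?thesis by (simp add: mult_ac)
qed

section \<open>Singular value decomposition, Gram matrix and truncation\<close>

lemma is_svdD:
  assumes "is_svd A U S V" "A \<in> carrier_mat n d"
  shows "orthogonal_mat n U" "orthogonal_mat d V" "S \<in> carrier_mat n d"
    "\<And>i j. i < n \<Longrightarrow> j < d \<Longrightarrow> i \<noteq> j \<Longrightarrow> S $$ (i, j) = 0"
    "\<And>i. i < min n d \<Longrightarrow> S $$ (i, i) \<ge> 0"
    "\<And>i j. i \<le> j \<Longrightarrow> j < min n d \<Longrightarrow> S $$ (j, j) \<le> S $$ (i, i)"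
    "A = U * S * transpose_mat V"
  using assms by (auto simp: is_svd_def orthogonal_mat_def diagonal_mat_def)

text \<open>Singular values count from 1, matrix indices from 0. The default 0 allows later sums to
  run over all \<open>j < n\<close>.\<close>

lemma sing_val_Suc:
  assumes "S \<in> carrier_mat n d"
  shows "sing_val S (Suc j) = (if j < min n d then S $$ (j, j) else 0)"
  using assms by (auto simp: sing_val_def)

text \<open>The default 0 continues the non-increasing order past the last singular value.\<close>

lemma sing_val_antimono:
  assumes svd: "is_svd A U S V" "A \<in> carrier_mat n d" and ij: "i \<le> j"
  shows "(sing_val S (Suc j))\<^sup>2 \<le> (sing_val S (Suc i))\<^sup>2"
  using is_svdD(5,6)[OF svd] ij by (auto simp: sing_val_Suc[OF is_svdD(3)[OF svd]] intro: power_mono)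

text \<open>The factor \<open>V\<close> cancels, and \<open>S * transpose_mat S\<close> is diagonal,
  padded with zeros if \<open>d < n\<close>. This is the spectral form that the perturbation bounds
  work with.\<close>

lemma svd_gram:
  assumes svd: "is_svd A U S V" "A \<in> carrier_mat n d"
  shows "A * transpose_mat A = U * mat_diag n (\<lambda>j. (sing_val S (Suc j))\<^sup>2) * transpose_mat U"
proof -
  note D = is_svdD[OF svd]
  note c = orthogonal_matD[OF D(1)] and c' = orthogonal_matD[OF D(2)]
  have ST: "transpose_mat S \<in> carrier_mat d n" using D(3) by simp
  have SS: "S * transpose_mat S = mat_diag n (\<lambda>j. (sing_val S (Suc j))\<^sup>2)"
  proof (rule eq_matI)
    fix i j assume "i < dim_row (mat_diag n (\<lambda>j. (sing_val S (Suc j))\<^sup>2))"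
      "j < dim_col (mat_diag n (\<lambda>j. (sing_val S (Suc j))\<^sup>2))"
    then have ij: "i < n" "j < n" by (auto simp: mat_diag_def)
    have "(S * transpose_mat S) $$ (i, j) = (\<Sum>l<d. S $$ (i, l) * S $$ (j, l))"
      using ij D(3) by (simp add: scalar_prod_def lessThan_atLeast0)
    also have "\<dots> = (\<Sum>l<d. if i = l then S $$ (i, l) * S $$ (j, l) else 0)"
      using ij D(4) by (intro sum.cong) auto
    also have "\<dots> = (if i < d then S $$ (i, i) * S $$ (j, i) else 0)"
      by (simp add: sum.delta)
    also have "\<dots> = mat_diag n (\<lambda>j. (sing_val S (Suc j))\<^sup>2) $$ (i, j)"
      using ij D(4) by (auto simp: mat_diag_def sing_val_Suc[OF D(3)] power2_eq_square)
    finally show "(S * transpose_mat S) $$ (i, j) = mat_diag n (\<lambda>j. (sing_val S (Suc j))\<^sup>2) $$ (i, j)" .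
  qed (use D(3) in \<open>auto simp: mat_diag_def\<close>)
  have US: "U * S \<in> carrier_mat n d" using c D(3) by auto
  have "transpose_mat A = V * transpose_mat (U * S)"
    using transpose_mult[OF US c'(2)] D(7) by simp
  then have "A * transpose_mat A = (U * S) * transpose_mat V * (V * transpose_mat (U * S))"
    using D(7) by simp
  also have "\<dots> = (U * S) * (transpose_mat V * (V * transpose_mat (U * S)))"
    by (rule assoc_mult_mat[OF US c'(2)]) (use US c'(1) in auto)
  also have "transpose_mat V * (V * transpose_mat (U * S)) = transpose_mat V * V * transpose_mat (U * S)"
    by (rule assoc_mult_mat[OF c'(2,1), symmetric]) (use US in auto)
  also have "\<dots> = transpose_mat S * transpose_mat U"
    using c'(3) transpose_mult[OF c(1) D(3)] left_mult_one_mat[OF mult_carrier_mat[OF ST c(2)]] by simp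
  also have "(U * S) * (transpose_mat S * transpose_mat U) = U * S * transpose_mat S * transpose_mat U"
    by (rule assoc_mult_mat[OF US ST c(2), symmetric])
  also have "U * S * transpose_mat S = U * (S * transpose_mat S)"
    by (rule assoc_mult_mat[OF c(1) D(3) ST])
  finally show ?thesis by (simp only: SS)
qed

text \<open>Places the truncation between the same full matrices \<open>U\<close> and
  \<open>V\<close> as \<open>A\<close>, so that the two can be subtracted in the middle
  factor.\<close>

lemma trunc_svd_conv_mat:
  assumes svd: "is_svd A U S V" "A \<in> carrier_mat n d" and k: "k \<le> n" "k \<le> d"
  shows "trunc_svd U S V k
    = U * mat n d (\<lambda>(i, j). if i < k then S $$ (i, j) else 0) * transpose_mat V"
proof -
  note D = is_svdD[OF svd]
  note c = orthogonal_matD[OF D(1)] and c' = orthogonal_matD[OF D(2)]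
  define R where "R = mat n d (\<lambda>(i, j). if i < k then S $$ (i, j) else 0)"
  have R: "R \<in> carrier_mat n d" by (simp add: R_def)
  have FU: "first_cols U k \<in> carrier_mat n k" using c by (simp add: first_cols_def)
  have FUS: "first_cols U k * top_sing S k = mat n k (\<lambda>(i, j). U $$ (i, j) * sing_val S (Suc j))"
    unfolding top_sing_def mat_diag_mult_right[OF FU]
    by (rule eq_matI) (use c in \<open>auto simp: first_cols_def\<close>)
  have UR: "(U * R) $$ (i, j) = (if j < k then U $$ (i, j) * sing_val S (Suc j) else 0)"
    if ij: "i < n" "j < d" for i j
  proof -
    have "(U * R) $$ (i, j) = (\<Sum>l<n. U $$ (i, l) * (if l < k then S $$ (l, j) else 0))"
      using ij c R by (simp add: scalar_prod_def lessThan_atLeast0 R_def)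
    also have "\<dots> = (\<Sum>l<n. if l = j then (if j < k then U $$ (i, j) * S $$ (j, j) else 0) else 0)"
      using ij D(4) by (intro sum.cong) auto
    also have "\<dots> = (if j < k then U $$ (i, j) * sing_val S (Suc j) else 0)"
      using ij k by (auto simp: sum.delta' sing_val_Suc[OF D(3)])
    finally show ?thesis .
  qed
  have "trunc_svd U S V k = U * R * transpose_mat V"
    unfolding trunc_svd_def FUS
  proof (rule eq_matI)
    fix i j assume "i < dim_row (U * R * transpose_mat V)" "j < dim_col (U * R * transpose_mat V)"
    then have ij: "i < n" "j < d" using c c' by auto
    have "(mat n k (\<lambda>(i, j). U $$ (i, j) * sing_val S (Suc j)) * transpose_mat (first_cols V k)) $$ (i, j)
        = (\<Sum>l<k. U $$ (i, l) * sing_val S (Suc l) * V $$ (j, l))"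
      using ij c' by (simp add: scalar_prod_def lessThan_atLeast0 first_cols_def)
    also have "\<dots> = (\<Sum>l<d. (U * R) $$ (i, l) * V $$ (j, l))"
      by (rule sum.mono_neutral_cong_left) (use k ij UR in auto)
    also have "\<dots> = (U * R * transpose_mat V) $$ (i, j)"
      using ij c(1) c' R mult_carrier_mat[OF c(1) R]
      by (simp add: scalar_prod_def[of "row (U * R) i"] lessThan_atLeast0 del: assoc_mult_mat row_mult)
    finally show "(mat n k (\<lambda>(i, j). U $$ (i, j) * sing_val S (Suc j)) * transpose_mat (first_cols V k)) $$ (i, j)
        = (U * R * transpose_mat V) $$ (i, j)" .
  qed (use c c' in \<open>auto simp: first_cols_def\<close>)
  then show ?thesis by (simp only: R_def)
qed

text \<open>The difference is \<open>U * (S - R) * transpose_mat V\<close>, where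
  \<open>S - R\<close> keeps just the diagonal entries of \<open>S\<close> from index
  \<open>k\<close> on; the orthogonal factors preserve the norm.\<close>

lemma frob_norm_svd_tail:
  assumes svd: "is_svd A U S V" "A \<in> carrier_mat n d" and k: "k \<le> n" "k \<le> d"
  shows "(frob_norm (A - trunc_svd U S V k))\<^sup>2 = (\<Sum>j\<in>{k..<n}. (sing_val S (Suc j))\<^sup>2)"
proof -
  note D = is_svdD[OF svd]
  note c = orthogonal_matD[OF D(1)] and c' = orthogonal_matD[OF D(2)]
  define R where "R = mat n d (\<lambda>(i, j). if i < k then S $$ (i, j) else 0)"
  have R: "R \<in> carrier_mat n d" by (simp add: R_def)
  have "A - trunc_svd U S V k = U * S * transpose_mat V - U * R * transpose_mat V"
    using trunc_svd_conv_mat[OF svd k] D(7) by (simp add: R_def)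
  also have "\<dots> = (U * S - U * R) * transpose_mat V"
    by (rule minus_mult_distrib_mat[symmetric]) (use c c' D(3) R in auto)
  also have "U * S - U * R = U * (S - R)"
    by (rule mult_minus_distrib_mat[OF c(1) D(3) R, symmetric])
  finally have "frob_norm (A - trunc_svd U S V k) = frob_norm (S - R)"
    by (simp only: frob_norm_orthogonal[OF D(1,2) minus_carrier_mat[OF R]])
  then have "(frob_norm (A - trunc_svd U S V k))\<^sup>2
      = (\<Sum>i<n. \<Sum>j<d. if i = j \<and> k \<le> i then (S $$ (i, i))\<^sup>2 else 0)"
    using R D(3,4) by (auto simp: frob_norm_power2 R_def intro!: sum.cong)
  also have "\<dots> = (\<Sum>i<n. if k \<le> i then (sing_val S (Suc i))\<^sup>2 else 0)"
  proof (rule sum.cong[OF refl])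
    fix i assume i: "i \<in> {..<n}"
    have "(\<Sum>j<d. if i = j \<and> k \<le> i then (S $$ (i, i))\<^sup>2 else 0)
        = (\<Sum>j<d. if i = j then (if k \<le> i then (S $$ (i, i))\<^sup>2 else 0) else 0)"
      by (intro sum.cong) auto
    also have "\<dots> = (if k \<le> i then (sing_val S (Suc i))\<^sup>2 else 0)"
      using i by (auto simp: sum.delta sing_val_Suc[OF D(3)])
    finally show "(\<Sum>j<d. if i = j \<and> k \<le> i then (S $$ (i, i))\<^sup>2 else 0)
        = (if k \<le> i then (sing_val S (Suc i))\<^sup>2 else 0)" .
  qed
  also have "\<dots> = (\<Sum>j\<in>{k..<n}. (sing_val S (Suc j))\<^sup>2)"
    by (rule sum.mono_neutral_cong_right) auto
  finally show ?thesis .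
qed

lemma frob_norm_svd:
  assumes svd: "is_svd A U S V" "A \<in> carrier_mat n d"
  shows "(frob_norm A)\<^sup>2 = (\<Sum>j<n. (sing_val S (Suc j))\<^sup>2)"
proof -
  note D = is_svdD[OF svd]
  have "(frob_norm A)\<^sup>2 = (frob_norm S)\<^sup>2"
    using frob_norm_orthogonal[OF D(1-3)] D(7) by simp
  also have "\<dots> = (\<Sum>i<n. \<Sum>j<d. if i = j then (S $$ (i, i))\<^sup>2 else 0)"
    unfolding frob_norm_power2 using D(3,4) by (intro sum.cong) auto
  also have "\<dots> = (\<Sum>i<n. (sing_val S (Suc i))\<^sup>2)"
    by (intro sum.cong) (auto simp: sum.delta sing_val_Suc[OF D(3)])
  finally show ?thesis .
qed

section \<open>Projection distances\<close>

text \<open>If \<open>U\<close> and \<open>S\<close> belong to an SVD of \<open>M\<close> and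
  \<open>k \<le> n\<close>, the subtracted sum is diagonal entry \<open>i\<close> of the
  rank-\<open>k\<close> truncation of \<open>M * transpose_mat M\<close>.\<close>

lemma proj_dist_eq:
  assumes "U \<in> carrier_mat n n" "A \<in> carrier_mat n d" "i < n"
  shows "proj_dist A U S k i
    = (l2_norm (row A i))\<^sup>2 - (\<Sum>j<k. (sing_val S (Suc j))\<^sup>2 * (U $$ (i, j))\<^sup>2)"
proof -
  have FU: "first_cols U k \<in> carrier_mat n k" using assms by (simp add: first_cols_def)
  have "first_cols U k * top_sing S k = mat n k (\<lambda>(i, j). U $$ (i, j) * sing_val S (Suc j))"
    unfolding top_sing_def mat_diag_mult_right[OF FU]
    by (rule eq_matI) (use assms in \<open>auto simp: first_cols_def\<close>)
  then show ?thesis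
    using assms by (simp add: proj_dist_def l2_norm_power2 power_mult_distrib mult.commute)
qed

text \<open>The row norms add up to all squared singular values; since the columns of
  \<open>U\<close> have norm 1, the subtracted terms add up to the first \<open>k\<close> of
  them.\<close>

lemma sum_proj_dist:
  assumes svd: "is_svd A U S V" "A \<in> carrier_mat n d" and k: "k \<le> n"
  shows "(\<Sum>i<n. proj_dist A U S k i) = (\<Sum>j\<in>{k..<n}. (sing_val S (Suc j))\<^sup>2)"
proof -
  note D = is_svdD[OF svd]
  note c = orthogonal_matD[OF D(1)]
  have "(\<Sum>i<n. proj_dist A U S k i)
      = (\<Sum>i<n. (l2_norm (row A i))\<^sup>2) - (\<Sum>i<n. \<Sum>j<k. (sing_val S (Suc j))\<^sup>2 * (U $$ (i, j))\<^sup>2)"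
    by (simp add: proj_dist_eq[OF c(1) svd(2)] sum_subtractf)
  also have "(\<Sum>i<n. (l2_norm (row A i))\<^sup>2) = (\<Sum>j<n. (sing_val S (Suc j))\<^sup>2)"
    using frob_norm_svd[OF svd] svd(2) by (simp add: frob_norm_power2_rows)
  also have "(\<Sum>i<n. \<Sum>j<k. (sing_val S (Suc j))\<^sup>2 * (U $$ (i, j))\<^sup>2)
      = (\<Sum>j<k. (sing_val S (Suc j))\<^sup>2 * (l2_norm (col U j))\<^sup>2)"
    using c k by (subst sum.swap) (auto simp: l2_norm_power2 sum_distrib_left intro!: sum.cong)
  also have "\<dots> = (\<Sum>j<k. (sing_val S (Suc j))\<^sup>2)"
    using k by (intro sum.cong) (auto simp: l2_norm_col_orthogonal[OF D(1)])
  also have "(\<Sum>j<n. (sing_val S (Suc j))\<^sup>2)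
      = (\<Sum>j<k. (sing_val S (Suc j))\<^sup>2) + (\<Sum>j\<in>{k..<n}. (sing_val S (Suc j))\<^sup>2)"
    using k by (simp add: lessThan_atLeast0 sum.atLeastLessThan_concat)
  finally show ?thesis by simp
qed

section \<open>Separated spectrum: parameters and conclusion\<close>

text \<open>The assumption on \<open>s = \<epsilon> sr(A)\<close> gives \<open>\<mu> \<le> \<Delta> / 125\<close>, so by Weyl's inequality the gap between the
  eigenvalues of \<open>A A\<^sup>T\<close> and those of \<open>A' A'\<^sup>T\<close> is at least \<open>(124 / 125) \<Delta> \<sigma>\<^sub>1\<^sup>2\<close>. Hence \<open>C = 2 / \<Delta>\<close> is
  admissible, and \<open>4 k \<mu> / \<Delta> \<le> s\<close>.\<close>

theorem lemma9:
  fixes A U S V A' U' S' V' :: "real mat"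
    and n d l k :: nat
    and \<Delta> \<epsilon> \<mu> :: real
  assumes A: "A \<in> carrier_mat n d"
    and svd: "is_svd A U S V"
    and pos: "\<forall>i\<in>{1..d}. sing_val S i > 0"
    and k: "1 \<le> k" "k < d"
    and \<Delta>: "\<Delta> > 0"
    and sep: "(sing_val S k)\<^sup>2 - (sing_val S (k + 1))\<^sup>2 \<ge> \<Delta> * (sing_val S 1)\<^sup>2"
    and \<epsilon>: "0 < \<epsilon>" "\<epsilon> \<le> min (\<Delta> * (real k)\<^sup>2) (real k) / stable_rank A S"
    and \<mu>: "\<mu> = \<epsilon> ^ 3 * (stable_rank A S) ^ 3 / (125 * real k ^ 4)"
    and A': "A' \<in> carrier_mat n l"
    and svd': "is_svd A' U' S' V'"
    and close: "op_norm (A * transpose_mat A - A' * transpose_mat A') \<le> \<mu> * (sing_val S 1)\<^sup>2"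
  shows "(\<Sum>i<n. \<bar>proj_dist A U S k i - proj_dist A U' S' k i\<bar>)
       \<le> \<epsilon> * (frob_norm A)\<^sup>2 / (frob_norm (A - trunc_svd U S V k))\<^sup>2
         * (\<Sum>i<n. proj_dist A U S k i)"
proof -
  define a where "a j = (sing_val S (Suc j))\<^sup>2" for j
  define b where "b j = (sing_val S' (Suc j))\<^sup>2" for j
  define \<sigma> where "\<sigma> = (sing_val S 1)\<^sup>2"
  define s where "s = \<epsilon> * stable_rank A S"
  define e where "e = \<mu> * \<sigma>"
  note D = is_svdD[OF svd A] and D' = is_svdD[OF svd' A']
  note c = orthogonal_matD[OF D(1)] and c' = orthogonal_matD[OF D'(1)]
  let ?B = "U * mat_diag n a * transpose_mat U" and ?B' = "U' * mat_diag n b * transpose_mat U'"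
  \<comment> \<open>\<open>sing_val\<close> is 0 beyond \<open>min n d\<close>, so a positive
    \<open>d\<close>-th value excludes \<open>n < d\<close>.\<close>
  have dn: "d \<le> n"
  proof -
    have "sing_val S d > 0" using pos k by auto
    then show ?thesis using D(3) by (auto simp: sing_val_def split: if_splits)
  qed
  have kn: "k < n" and k0: "real k > 0" using k dn by auto
  have a0: "a 0 = \<sigma>" by (simp add: a_def \<sigma>_def)
  have "sing_val S 1 > 0" using bspec[OF pos, of 1] k by simp
  then have \<sigma>: "\<sigma> > 0" by (simp add: \<sigma>_def)
  have a_anti: "a j \<le> a i" if "i \<le> j" for i j
    unfolding a_def by (rule sing_val_antimono[OF svd A that])
  have b_anti: "b j \<le> b i" if "i \<le> j" for i j
    unfolding b_def by (rule sing_val_antimono[OF svd' A' that])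
  have a_nn: "a j \<ge> 0" and b_nn: "b j \<ge> 0" for j by (auto simp: a_def b_def)
  \<comment> \<open>Since \<open>a\<close> counts from 0, \<open>a (k - 1)\<close> belongs to
    singular value number \<open>k\<close>.\<close>
  have gap: "a (k - 1) - a k \<ge> \<Delta> * \<sigma>"
    using sep k by (simp add: a_def \<sigma>_def)
  \<comment> \<open>The gap lies within the interval from 0 to \<sigma>. The resulting
    \<open>\<Delta> \<le> 1\<close> makes \<open>2 / \<Delta>\<close> at least 1, as required of
    \<open>C\<close>.\<close>
  have "\<Delta> * \<sigma> \<le> 1 * \<sigma>"
    using gap a_anti[of 0 "k - 1"] a_nn[of k] a0 by simp
  then have \<Delta>1: "\<Delta> \<le> 1" using \<sigma> by (simp only: mult_le_cancel_right_pos)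

  have tail: "(frob_norm (A - trunc_svd U S V k))\<^sup>2 = (\<Sum>i<n. proj_dist A U S k i)"
    using frob_norm_svd_tail[OF svd A] sum_proj_dist[OF svd A] kn k by simp
  have tail_pos: "(\<Sum>i<n. proj_dist A U S k i) > 0"
  proof -
    have "sing_val S (Suc k) > 0" using bspec[OF pos, of "Suc k"] k by simp
    then have "0 < a k" by (simp add: a_def)
    also have "\<dots> \<le> (\<Sum>j\<in>{k..<n}. a j)"
      using kn a_nn by (intro member_le_sum) auto
    finally show ?thesis using sum_proj_dist[OF svd A] kn by (simp add: a_def)
  qed
  have frob: "(frob_norm A)\<^sup>2 = (\<Sum>j<n. a j)"
    using frob_norm_svd[OF svd A] by (simp add: a_def)
  have "0 < a 0" using a0 \<sigma> by simp
  also have "\<dots> \<le> (\<Sum>j<n. a j)"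
    using kn a_nn by (intro member_le_sum) auto
  finally have frob_pos: "(frob_norm A)\<^sup>2 > 0" by (simp only: frob)
  have sr_pos: "stable_rank A S > 0"
    using frob_pos \<sigma> by (simp add: stable_rank_def \<sigma>_def)
  have s\<sigma>: "s * \<sigma> = \<epsilon> * (frob_norm A)\<^sup>2"
    using \<sigma> by (simp add: s_def stable_rank_def \<sigma>_def)
  have s_pos: "s > 0" using \<epsilon>(1) sr_pos by (simp add: s_def)
  have "s \<le> min (\<Delta> * (real k)\<^sup>2) (real k)"
    using \<epsilon>(2) sr_pos by (simp add: s_def pos_le_divide_eq)
  then have sk: "s \<le> real k" and s\<Delta>: "s \<le> \<Delta> * (real k)\<^sup>2" by auto
  have \<mu>_eq: "\<mu> = s ^ 3 / (125 * real k ^ 4)"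
    by (simp add: \<mu> s_def power_mult_distrib)
  have \<mu>_pos: "\<mu> > 0" using s_pos k0 by (simp add: \<mu>_eq)
  have \<mu>_le: "125 * \<mu> * real k \<le> \<Delta> * s"
  proof -
    have "125 * \<mu> * real k = s * (s * s) / real k ^ 3"
      using k0 by (simp add: \<mu>_eq field_simps power_numeral_reduce)
    \<comment> \<open>Of the three factors \<open>s\<close>, one is kept, one is bounded by
      \<open>\<Delta> * (real k)\<^sup>2\<close> and one by \<open>real k\<close>.\<close>
    also have "\<dots> \<le> s * (\<Delta> * (real k)\<^sup>2 * real k) / real k ^ 3"
      using s_pos k0 \<Delta> sk s\<Delta> by (intro divide_right_mono mult_left_mono mult_mono) auto
    also have "\<dots> = \<Delta> * s"
      using k0 by (simp add: field_simps power_numeral_reduce)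
    finally show ?thesis .
  qed
  have \<mu>\<Delta>: "125 * \<mu> \<le> \<Delta>"
  proof -
    have "125 * \<mu> * real k \<le> \<Delta> * real k"
      using \<mu>_le sk \<Delta> by (meson less_imp_le mult_left_mono order_trans)
    then show ?thesis using k0 by (simp only: mult_le_cancel_right_pos)
  qed
  have e_pos: "e > 0" using \<mu>_pos \<sigma> by (simp add: e_def)
  have e\<Delta>: "125 * e \<le> \<Delta> * \<sigma>" using mult_right_mono[OF \<mu>\<Delta>, of \<sigma>] \<sigma> by (simp add: e_def)

  have BA: "?B = A * transpose_mat A" and BA': "?B' = A' * transpose_mat A'"
    unfolding a_def b_def using svd_gram[OF svd A] svd_gram[OF svd' A'] by auto
  have B: "A * transpose_mat A \<in> carrier_mat n n" and B': "A' * transpose_mat A' \<in> carrier_mat n n"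
    using A A' by auto
  have near: "l2_norm (?B *\<^sub>v x - ?B' *\<^sub>v x) \<le> e * l2_norm x" if x: "x \<in> carrier_vec n" for x
  proof -
    have "?B *\<^sub>v x - ?B' *\<^sub>v x = (A * transpose_mat A - A' * transpose_mat A') *\<^sub>v x"
      unfolding BA BA' by (rule minus_mult_distrib_mat_vec[OF B B' x, symmetric])
    then have "l2_norm (?B *\<^sub>v x - ?B' *\<^sub>v x)
        \<le> op_norm (A * transpose_mat A - A' * transpose_mat A') * l2_norm x"
      using l2_norm_mult_mat_vec_le[OF minus_carrier_mat[OF B'] x] by simp
    also have "\<dots> \<le> e * l2_norm x"
      using close by (intro mult_right_mono) (auto simp: e_def \<sigma>_def)
    finally show ?thesis .
  qed
  have quad: "\<bar>x \<bullet> (?B *\<^sub>v x) - x \<bullet> (?B' *\<^sub>v x)\<bar> \<le> e * (l2_norm x)\<^sup>2" if x: "x \<in> carrier_vec n" for x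
  proof -
    have v: "?B *\<^sub>v x \<in> carrier_vec n" "?B' *\<^sub>v x \<in> carrier_vec n"
      unfolding BA BA' by (rule mult_mat_vec_carrier[OF B x] mult_mat_vec_carrier[OF B' x])+
    have "\<bar>x \<bullet> (?B *\<^sub>v x) - x \<bullet> (?B' *\<^sub>v x)\<bar> = \<bar>x \<bullet> (?B *\<^sub>v x - ?B' *\<^sub>v x)\<bar>"
      by (simp only: scalar_prod_minus_distrib[OF x v])
    also have "\<dots> \<le> l2_norm x * l2_norm (?B *\<^sub>v x - ?B' *\<^sub>v x)"
      using v x by (intro abs_scalar_prod_le_l2_norm[of _ n]) auto
    also have "\<dots> \<le> l2_norm x * (e * l2_norm x)"
      by (intro mult_left_mono near[OF x]) auto
    finally show ?thesis by (simp add: power2_eq_square mult_ac)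
  qed
  have weyl: "b j \<le> a j + e" if "j < n" for j
  proof (rule weyl_inequality[OF D(1) D'(1) a_anti b_anti that])
    fix x :: "real vec" assume "x \<in> carrier_vec n"
    from quad[OF this] show "x \<bullet> (?B' *\<^sub>v x) \<le> x \<bullet> (?B *\<^sub>v x) + e * (l2_norm x)\<^sup>2" by linarith
  qed
  have weyl': "a j \<le> b j + e" if "j < n" for j
  proof (rule weyl_inequality[OF D'(1) D(1) b_anti a_anti that])
    fix x :: "real vec" assume "x \<in> carrier_vec n"
    from quad[OF this] show "x \<bullet> (?B *\<^sub>v x) \<le> x \<bullet> (?B' *\<^sub>v x) + e * (l2_norm x)\<^sup>2" by linarith
  qed

  \<comment> \<open>\<open>\<sigma> + e\<close> bounds all \<open>a i\<close> and \<open>b j\<close>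
    with index below \<open>n\<close>, and \<open>\<Delta> * \<sigma> - e\<close> is what Weyl's
    inequality leaves of the gap. The left-hand side is at most \<open>126 / 125 * \<sigma>\<close>,
    the right-hand side at least \<open>248 / 125 * \<sigma>\<close>.\<close>
  have surviving_gap: "\<sigma> + e \<le> 2 / \<Delta> * (\<Delta> * \<sigma> - e)"
  proof -
    have "2 / \<Delta> * (\<Delta> * \<sigma> - e) = 2 * \<sigma> - 2 * (e / \<Delta>)"
      using \<Delta> by (simp add: field_simps)
    moreover have "125 * (e / \<Delta>) \<le> \<sigma>" using e\<Delta> \<Delta> by (simp add: field_simps)
    moreover have "125 * e \<le> \<sigma>"
      using e\<Delta> mult_right_mono[OF \<Delta>1, of \<sigma>] \<sigma> by linarith
    ultimately show ?thesis using \<sigma> by linarith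
  qed
  have C: "x \<le> 2 / \<Delta> * g" if "x \<le> \<sigma> + e" "\<Delta> * \<sigma> - e \<le> g" for x g
    using that surviving_gap mult_left_mono[of "\<Delta> * \<sigma> - e" g "2 / \<Delta>"] \<Delta> by simp
  have "(\<Sum>i<n. \<bar>(\<Sum>j<k. a j * (U $$ (i, j))\<^sup>2) - (\<Sum>j<k. b j * (U' $$ (i, j))\<^sup>2)\<bar>)
      \<le> 2 * real k * (2 / \<Delta>) * e"
  proof (rule sum_abs_diag_truncation_diff_le[OF D(1) D'(1)])
    show "k \<le> n" using kn by simp
    show "1 \<le> 2 / \<Delta>" using \<Delta> \<Delta>1 by simp
    fix i j
    {
      assume "i < k" "k \<le> j"
      then have "i \<le> k - 1" by simp
      \<comment> \<open>Here \<open>a i \<ge> a (k - 1)\<close> and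
        \<open>b j \<le> b k \<le> a k + e\<close>. In the other case
        \<open>b j \<ge> b (k - 1) \<ge> a (k - 1) - e\<close> and
        \<open>a i \<le> a k\<close>.\<close>
      then have "\<Delta> * \<sigma> - e \<le> a i - b j"
        using gap a_anti[of i "k - 1"] weyl[OF kn] b_anti[OF \<open>k \<le> j\<close>] by linarith
      then show "\<bar>a i\<bar> \<le> 2 / \<Delta> * \<bar>a i - b j\<bar>"
        using a_anti[of 0 i] a0 a_nn[of i] e_pos by (intro C) auto
    next
      assume "j < k" "k \<le> i"
      then have "j \<le> k - 1" "k - 1 < n" using kn by simp_all
      then have "\<Delta> * \<sigma> - e \<le> b j - a i"
        using gap a_anti[OF \<open>k \<le> i\<close>] weyl'[of "k - 1"] b_anti[of j "k - 1"] by linarith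
      then show "\<bar>b j\<bar> \<le> 2 / \<Delta> * \<bar>a i - b j\<bar>"
        using b_anti[of 0 j] weyl[of 0] a0 b_nn[of j] kn by (intro C) auto
    }
  qed (rule near)
  also have "\<dots> = 4 * (\<mu> * real k) / \<Delta> * \<sigma>"
    by (simp add: e_def)
  also have "\<dots> \<le> s * \<sigma>"
  proof (rule mult_right_mono)
    have "4 * (\<mu> * real k) \<le> s * \<Delta>"
      using \<mu>_le mult_pos_pos[OF \<mu>_pos k0] by (simp add: mult_ac)
    then show "4 * (\<mu> * real k) / \<Delta> \<le> s" using \<Delta> by (simp add: pos_divide_le_eq)
  qed (use \<sigma> in simp)
  \<comment> \<open>Both distances contain the same squared norm of row \<open>i\<close> of
    \<open>A\<close>, which cancels.\<close>
  also have "(\<Sum>i<n. \<bar>(\<Sum>j<k. a j * (U $$ (i, j))\<^sup>2) - (\<Sum>j<k. b j * (U' $$ (i, j))\<^sup>2)\<bar>)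
      = (\<Sum>i<n. \<bar>proj_dist A U S k i - proj_dist A U' S' k i\<bar>)"
    by (intro sum.cong refl)
       (simp add: proj_dist_eq[OF c(1) A] proj_dist_eq[OF c'(1) A] a_def b_def abs_minus_commute)
  finally show ?thesis
    using tail tail_pos s\<sigma> by simp
qed

end
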